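(* Let $H$ be a real Hilbert space and let $T \in \mathcal{B}(H)$ be a self-adjoint operator. If $m_r(T) > 0$, then $T$ is positive semidefinite and $R(T)$ is closed.
   Context: $\mathcal{B}(H)$ is the set of bounded linear operators on $H$; $T^*$ and $R(T)$ denote the adjoint and the range of $T$. Define $m_r(T) = \inf\{\langle Tx,x\rangle : x \in R(T^* ),\ \|x\|=1\}$ (infimum in the extended reals, with the usual convention $\inf\emptyset=+\infty$). A self-adjoint operator $T$ is positive semidefinite if $\langle Tx,x\rangle \ge 0$ for all $x\in H$. *)

theory Defs
  imports "HOL-Analysis.Analysis"
begin

text \<open>
  A real Hilbert space is a type of sort \<open>{real_inner, complete_space}\<close>, and
  \<open>\<B>(H)\<close> consists of the functions \<open>T\<close> with \<open>bounded_linear T\<close>.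
  The adjoint is the library constant \<open>adjoint\<close>. The library defines it with a choice
  operator and shows that it satisfies the adjoint equation only on Euclidean spaces;
  lemma \<open>hilbert_adjoint\<close> below shows it for bounded operators between Hilbert spaces,
  so that \<open>adjoint T\<close> is the Hilbert space adjoint there.
\<close>

lemma riesz_exists:
  fixes f :: "'a::{real_inner,complete_space} \<Rightarrow> real"
  assumes "bounded_linear f"
  shows "\<exists>z. \<forall>v. f v = v \<bullet> z"
proof -
  interpret f: bounded_linear f by fact
  define J where "J x = x \<bullet> x - 2 * f x" for x
  obtain K where K: "\<And>x. norm (f x) \<le> norm x * K"
    using f.bounded by blast
  have low: "- K\<^sup>2 \<le> J x" for x
  proof -
    have "f x \<le> norm x * K" using K[of x] by simp
    moreover have "0 \<le> (norm x - K)\<^sup>2" by simp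
    ultimately show ?thesis
      by (simp add: J_def dot_square_norm power2_diff algebra_simps)
  qed
  have bdd: "bdd_below (range J)"
    using low by (auto intro!: bdd_belowI)
  define d where "d = Inf (range J)"
  have d_le: "d \<le> J x" for x
    unfolding d_def by (rule cInf_lower) (use bdd in auto)
  have par: "(norm (x - y))\<^sup>2 \<le> 2 * (J x - d) + 2 * (J y - d)" for x y
  proof -
    define m where "m = (1/2) *\<^sub>R (x + y)"
    have "(norm (x - y))\<^sup>2 = 2 * (J x + J y - 2 * J m)"
      by (simp add: J_def m_def power2_norm_eq_inner f.scaleR f.add inner_commute algebra_simps)
    also have "\<dots> \<le> 2 * (J x + J y - 2 * d)"
      using d_le[of m] by simp
    finally show ?thesis by (simp add: algebra_simps)
  qed
  have "\<exists>x. J x < d + 1 / real (Suc n)" for n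
  proof (rule ccontr)
    assume "\<not> ?thesis"
    then have "d + 1 / real (Suc n) \<le> d"
      unfolding d_def by (intro cInf_greatest) (auto simp: not_less d_def)
    then show False by simp
  qed
  then obtain X where X: "\<And>n. J (X n) < d + 1 / real (Suc n)" by metis
  have "Cauchy X"
  proof (rule metric_CauchyI)
    fix e :: real assume "0 < e"
    then have "0 < (e/2)\<^sup>2 / 4" by simp
    then obtain N where N: "1 / real (Suc N) < (e/2)\<^sup>2 / 4"
      by (rule nat_approx_posE)
    have "dist (X m) (X n) \<le> e/2" if "m \<ge> N" "n \<ge> N" for m n
    proof -
      have small: "J (X k) - d \<le> (e/2)\<^sup>2 / 4" if "k \<ge> N" for k
      proof -
        have "J (X k) - d \<le> 1 / real (Suc k)" using X[of k] by simp
        also have "\<dots> \<le> 1 / real (Suc N)" using that by (simp add: divide_simps)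
        also have "\<dots> < (e/2)\<^sup>2 / 4" by (rule N)
        finally show ?thesis by simp
      qed
      have "(norm (X m - X n))\<^sup>2 \<le> 2 * (J (X m) - d) + 2 * (J (X n) - d)"
        by (rule par)
      also have "\<dots> \<le> 2 * ((e/2)\<^sup>2 / 4) + 2 * ((e/2)\<^sup>2 / 4)"
        by (intro add_mono mult_left_mono small that) auto
      also have "\<dots> = (e/2)\<^sup>2" by simp
      finally have "norm (X m - X n) \<le> e/2"
        by (rule power2_le_imp_le) (use \<open>0 < e\<close> in simp)
      then show ?thesis by (simp add: dist_norm)
    qed
    moreover have "e / 2 < e" using \<open>0 < e\<close> by simp
    ultimately show "\<exists>N. \<forall>m\<ge>N. \<forall>n\<ge>N. dist (X m) (X n) < e"
      by (intro exI[of _ N] allI impI) (rule le_less_trans)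
  qed
  then obtain z where z: "X \<longlonglongrightarrow> z"
    using Cauchy_convergent convergent_def by blast
  have "(\<lambda>n. J (X n)) \<longlonglongrightarrow> J z"
    unfolding J_def by (intro tendsto_intros z f.tendsto)
  moreover have "(\<lambda>n. d + 1 / real (Suc n)) \<longlonglongrightarrow> d + 0"
    by (intro tendsto_add tendsto_const LIMSEQ_Suc[OF lim_1_over_n[where 'a=real]])
  ultimately have "J z \<le> d + 0"
    by (rule LIMSEQ_le) (intro exI[of _ 0] allI impI less_imp_le X)
  then have min: "J z \<le> J x" for x using d_le[of x] by simp
  have "f v = v \<bullet> z" for v
  proof (cases "v = 0")
    case False
    then have pos: "0 < v \<bullet> v" by simp
    define a where "a = f v - v \<bullet> z"
    define t where "t = a / (v \<bullet> v)"
    have "J (z + t *\<^sub>R v) = J z - 2 * t * a + t * t * (v \<bullet> v)"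
      by (simp add: J_def a_def f.scaleR f.add inner_commute algebra_simps)
    also have "\<dots> = J z - a * a / (v \<bullet> v)"
      using pos by (simp add: t_def field_simps)
    finally have "a * a / (v \<bullet> v) \<le> 0" using min[of "z + t *\<^sub>R v"] by simp
    with pos have "a * a \<le> 0" by (auto simp: divide_le_0_iff simp del: inner_gt_zero_iff)
    then have "a = 0" by (auto simp: mult_le_0_iff)
    then show ?thesis by (simp add: a_def)
  qed (simp add: f.zero)
  then show ?thesis by blast
qed

lemma hilbert_adjoint:
  fixes T :: "'a::{real_inner,complete_space} \<Rightarrow> 'b::real_inner"
  assumes "bounded_linear T"
  shows "T x \<bullet> y = x \<bullet> adjoint T y"
proof -
  have "\<exists>z. \<forall>v. T v \<bullet> y = v \<bullet> z" for y
    by (rule riesz_exists) (rule bounded_linear_compose[OF bounded_linear_inner_left assms])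
  then obtain g where "\<forall>y v. T v \<bullet> y = v \<bullet> g y" by metis
  then have *: "\<forall>x y. T x \<bullet> y = x \<bullet> g y" by blast
  with adjoint_unique[OF *] show ?thesis by simp
qed

definition self_adjoint :: "('a::real_inner \<Rightarrow> 'a) \<Rightarrow> bool" where
  "self_adjoint T \<longleftrightarrow> adjoint T = T"

definition positive_semidefinite :: "('a::real_inner \<Rightarrow> 'a) \<Rightarrow> bool" where
  "positive_semidefinite T \<longleftrightarrow> self_adjoint T \<and> (\<forall>x. 0 \<le> T x \<bullet> x)"

text \<open>
  The infimum is taken in \<open>ereal\<close>, so it is \<open>\<infinity>\<close> over the empty set
  (that is, when \<open>adjoint T = 0\<close>).
\<close>

definition m_r :: "('a::real_inner \<Rightarrow> 'a) \<Rightarrow> ereal" where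
  "m_r T = (INF x \<in> {x \<in> range (adjoint T). norm x = 1}. ereal (T x \<bullet> x))"

end

theory Submission
  imports Defs
begin

text \<open>
  Let \<open>M\<close> be the closure of \<open>R(T)\<close>. The hypothesis makes \<open>T\<close> coercive on \<open>M\<close>, so for small
  \<open>c > 0\<close> the map \<open>v \<mapsto> v + c (y - T v)\<close> is a contraction of \<open>M\<close> for each \<open>y \<in> M\<close>. Its fixed
  point solves \<open>T p = y\<close>, whence \<open>R(T) = M\<close> is closed and \<open>T\<close> maps \<open>R(T)\<close> onto itself. Given
  \<open>x\<close>, choose \<open>p \<in> R(T)\<close> with \<open>T p = T x\<close>; by symmetry \<open>\<langle>T x, x\<rangle> = \<langle>T p, p\<rangle> \<ge> 0\<close>.
\<close>

lemma subspace_closure: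
  fixes S :: "'a::real_normed_vector set"
  assumes "subspace S"
  shows "subspace (closure S)"
proof (rule subspaceI)
  show "0 \<in> closure S"
    using subspace_0[OF assms] closure_subset by blast
next
  fix x y assume "x \<in> closure S" "y \<in> closure S"
  then obtain f g where "\<And>n. f n \<in> S" "f \<longlonglongrightarrow> x" "\<And>n. g n \<in> S" "g \<longlonglongrightarrow> y"
    by (auto simp: closure_sequential)
  then have "\<forall>n. f n + g n \<in> S" "(\<lambda>n. f n + g n) \<longlonglongrightarrow> x + y"
    using subspace_add[OF assms] by (auto intro: tendsto_add)
  then show "x + y \<in> closure S"
    unfolding closure_sequential by (intro exI conjI)
next
  fix c x assume "x \<in> closure S"
  then obtain f where "\<And>n. f n \<in> S" "f \<longlonglongrightarrow> x"
    by (auto simp: closure_sequential)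
  then have "\<forall>n. c *\<^sub>R f n \<in> S" "(\<lambda>n. c *\<^sub>R f n) \<longlonglongrightarrow> c *\<^sub>R x"
    using subspace_scale[OF assms] by (auto intro: tendsto_scaleR)
  then show "c *\<^sub>R x \<in> closure S"
    unfolding closure_sequential by (intro exI conjI)
qed

text \<open>Expanding \<open>(norm (v - c *\<^sub>R T v))\<^sup>2\<close>, coercivity gains at least
  \<open>2 * c * m\<close> in the linear term, while boundedness costs at most
  \<open>c\<^sup>2 * K\<^sup>2\<close>. For small \<open>c\<close> the gain wins, and Banach's
  theorem applies because a closed \<open>M\<close> is complete.\<close>

lemma coercive_imp_onto:
  fixes T :: "'a::{real_inner,complete_space} \<Rightarrow> 'a"
  assumes T: "bounded_linear T" and M: "subspace M" "closed M" and TM: "T ` M \<subseteq> M"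
    and m: "0 < m" and coercive: "\<And>v. v \<in> M \<Longrightarrow> m * (norm v)\<^sup>2 \<le> T v \<bullet> v"
  shows "T ` M = M"
proof
  show "M \<subseteq> T ` M"
  proof
    fix y assume y: "y \<in> M"
    interpret T: bounded_linear T by fact
    obtain K0 where K0: "\<And>x. norm (T x) \<le> norm x * K0"
      using T.bounded by blast
    \<comment> \<open>\<open>K0\<close> is not known to be positive. The maximum gives
      \<open>0 < K\<close>, and \<open>m \<le> K\<close> keeps the radicand of \<open>q\<close>
      nonnegative.\<close>
    define K where "K = max K0 m"
    have K: "norm (T x) \<le> norm x * K" for x
      by (rule order_trans[OF K0]) (simp add: K_def mult_left_mono)
    have mK: "m \<le> K" and "0 < K" using m by (auto simp: K_def)
    \<comment> \<open>This \<open>c\<close> minimises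
      \<open>1 - 2 * c * m + c\<^sup>2 * K\<^sup>2\<close>; the minimum is
      \<open>q\<^sup>2\<close>.\<close>
    define c where "c = m / K\<^sup>2"
    define q where "q = sqrt (1 - m\<^sup>2 / K\<^sup>2)"
    have "c > 0" using m \<open>0 < K\<close> by (simp add: c_def)
    have q2: "0 \<le> 1 - m\<^sup>2 / K\<^sup>2"
      using mK m \<open>0 < K\<close> by (simp add: power_mono)
    have q: "0 \<le> q" "q < 1"
      using q2 m \<open>0 < K\<close> by (auto simp: q_def)
    have contr: "norm (v - c *\<^sub>R T v) \<le> q * norm v" if "v \<in> M" for v
    proof (rule power2_le_imp_le)
      have "(norm (T v))\<^sup>2 \<le> (norm v * K)\<^sup>2"
        using K by (intro power_mono) auto
      then have 1: "c\<^sup>2 * (norm (T v))\<^sup>2 \<le> c\<^sup>2 * (norm v * K)\<^sup>2"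
        by (intro mult_left_mono) auto
      have 2: "2 * c * (m * (norm v)\<^sup>2) \<le> 2 * c * (T v \<bullet> v)"
        using coercive[OF that] \<open>c > 0\<close> by (intro mult_left_mono) auto
      have "(norm (v - c *\<^sub>R T v))\<^sup>2 = (norm v)\<^sup>2 - 2 * c * (T v \<bullet> v) + c\<^sup>2 * (norm (T v))\<^sup>2"
        unfolding power2_norm_eq_inner by (simp add: inner_commute algebra_simps power2_eq_square)
      also have "\<dots> \<le> (norm v)\<^sup>2 - 2 * c * (m * (norm v)\<^sup>2) + c\<^sup>2 * (norm v * K)\<^sup>2"
        using 1 2 by linarith
      also have "\<dots> = (1 - m\<^sup>2 / K\<^sup>2) * (norm v)\<^sup>2"
        using \<open>0 < K\<close> by (simp add: c_def field_simps power2_eq_square)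
      also have "\<dots> = (q * norm v)\<^sup>2"
        using q2 by (simp add: q_def power_mult_distrib)
      finally show "(norm (v - c *\<^sub>R T v))\<^sup>2 \<le> (q * norm v)\<^sup>2" .
    qed (use q in simp)
    define f where "f v = v + c *\<^sub>R (y - T v)" for v
    have "\<exists>!p\<in>M. f p = p"
    proof (rule Banach_fix)
      show "complete M" using M(2) by (simp add: complete_eq_closed)
      show "M \<noteq> {}" using y by blast
      show "0 \<le> q" "q < 1" by (fact q)+
      show "f ` M \<subseteq> M"
        using y TM M(1) by (auto simp: f_def intro!: subspace_add subspace_diff subspace_scale)
      fix u v assume uv: "u \<in> M" "v \<in> M"
      have "f u - f v = (u - v) - c *\<^sub>R T (u - v)"
        by (simp add: f_def T.diff algebra_simps)
      then show "dist (f u) (f v) \<le> q * dist u v"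
        using contr[of "u - v"] uv M(1) by (simp add: dist_norm subspace_diff)
    qed
    then obtain p where "p \<in> M" "f p = p" by blast
    then show "y \<in> T ` M" using \<open>c > 0\<close> by (auto simp: f_def)
  qed
qed (fact TM)

text \<open>Both sides of the inequality are continuous in \<open>v\<close>, so it cuts out a closed
  set. This carries coercivity from the range to its closure, where completeness is
  available.\<close>

lemma coercive_on_closure:
  fixes T :: "'a::real_inner \<Rightarrow> 'a"
  assumes T: "bounded_linear T"
    and coercive: "\<And>v. v \<in> S \<Longrightarrow> m * (norm v)\<^sup>2 \<le> T v \<bullet> v" and v: "v \<in> closure S"
  shows "m * (norm v)\<^sup>2 \<le> T v \<bullet> v"
proof -
  interpret T: bounded_linear T by fact
  have "closed {v. m * (norm v)\<^sup>2 \<le> T v \<bullet> v}"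
    by (intro closed_Collect_le continuous_intros T.continuous_on)
  then have "closure S \<subseteq> {v. m * (norm v)\<^sup>2 \<le> T v \<bullet> v}"
    using coercive by (intro closure_minimal) auto
  then show ?thesis using v by blast
qed

text \<open>Both sides are homogeneous of degree two, so a bound on unit vectors of the subspace
  extends to all of it.\<close>

lemma m_r_pos_imp_coercive:
  assumes T: "linear T" and sub: "subspace (range (adjoint T))" and pos: "m_r T > 0"
  obtains m where "m > 0" "\<And>v. v \<in> range (adjoint T) \<Longrightarrow> m * (norm v)\<^sup>2 \<le> T v \<bullet> v"
proof -
  interpret T: linear T by fact
  \<comment> \<open>\<open>m_r T\<close> may be \<open>\<infinity>\<close>, so a real constant
    strictly below it is taken instead.\<close>
  obtain m where m: "0 < ereal m" "ereal m < m_r T"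
    using ereal_dense2[OF pos] by blast
  show ?thesis
  proof
    show "m > 0" using m by simp
    fix v assume v: "v \<in> range (adjoint T)"
    show "m * (norm v)\<^sup>2 \<le> T v \<bullet> v"
    proof (cases "v = 0")
      case False
      define u where "u = (1 / norm v) *\<^sub>R v"
      have "u \<in> range (adjoint T)" "norm u = 1"
        using v sub False by (simp_all add: u_def subspace_scale)
      then have "m_r T \<le> ereal (T u \<bullet> u)"
        unfolding m_r_def by (intro INF_lower) simp
      then have "m \<le> T u \<bullet> u"
        using m by (metis ereal_less_eq(3) less_imp_le order_trans)
      also have "\<dots> = (T v \<bullet> v) / (norm v)\<^sup>2"
        by (simp add: u_def T.scaleR power2_eq_square)
      finally show ?thesis using False by (simp add: field_simps)
    qed (simp add: T.zero)
  qed
qed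

theorem theorem3p1:
  fixes T :: "'a::{real_inner,complete_space} \<Rightarrow> 'a"
  assumes "bounded_linear T" and "self_adjoint T" and "m_r T > 0"
  shows "positive_semidefinite T \<and> closed (range T)"
proof -
  interpret T: bounded_linear T by fact
  have adj: "adjoint T = T" using assms(2) by (simp add: self_adjoint_def)
  have sym: "T x \<bullet> y = x \<bullet> T y" for x y
    using hilbert_adjoint[OF assms(1)] by (simp add: adj)
  have sub: "subspace (range T)"
    by (rule linear_subspace_image[OF T.linear_axioms subspace_UNIV])
  obtain m where m: "m > 0" and coercive: "\<And>v. v \<in> range T \<Longrightarrow> m * (norm v)\<^sup>2 \<le> T v \<bullet> v"
    using m_r_pos_imp_coercive[OF T.linear_axioms _ assms(3)] sub unfolding adj by blast
  have sub_closure: "T ` S \<subseteq> closure (range T)" for S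
    using closure_subset[of "range T"] by blast
  have onto: "T ` closure (range T) = closure (range T)"
    by (rule coercive_imp_onto[OF assms(1) subspace_closure[OF sub] closed_closure sub_closure m])
      (rule coercive_on_closure[OF assms(1) coercive])
  \<comment> \<open>Every point of the closure is a value of \<open>T\<close> by
    \<open>onto\<close>, hence lies in the range.\<close>
  then have eq: "closure (range T) = range T"
    using closure_subset[of "range T"] by blast
  have "0 \<le> T x \<bullet> x" for x
  proof -
    \<comment> \<open>The resulting \<open>p\<close> differs from \<open>x\<close> by a kernel
      vector, which by symmetry does not change the quadratic form. Coercivity is thus needed only
      at \<open>p\<close>.\<close>
    have "T x \<in> T ` range T" using onto unfolding eq by blast
    then obtain p where p: "T x = T p" "p \<in> range T" by (rule imageE)
    have "0 \<le> m * (norm p)\<^sup>2" using m by simp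
    also have "\<dots> \<le> T p \<bullet> p" using coercive[OF p(2)] .
    also have "\<dots> = T x \<bullet> p" by (simp only: p(1))
    also have "\<dots> = x \<bullet> T p" by (rule sym)
    also have "\<dots> = T x \<bullet> x" by (simp only: p(1) inner_commute)
    finally show ?thesis .
  qed
  moreover have "closed (range T)" using closed_closure[of "range T"] by (simp only: eq)
  ultimately show ?thesis using assms(2) by (simp add: positive_semidefinite_def)
qed

end
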